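(* Let $M$ be a compact finite-dimensional Riemannian manifold. For every continuous $f\colon M\to M$, the $1$-observable minimal Ilyashenko attractor $K$ of $f$ is the compact support of the set $\mathcal O_f$ of all SRB-like measures for $f$; that is, $K$ is the smallest compact subset of $M$ such that $\mu(K)=1$ for all $\mu\in\mathcal O_f$.
   Context: Let $m$ be the Lebesgue (Riemannian volume) measure on $M$, normalized so that $m(M)=1$; it need not be $f$-invariant. For a nonempty compact $K\subset M$, the basin of statistical attraction of $K$ is $A_K:=\{x\in M:\ \lim_{n\to+\infty}\frac1n\sum_{j=0}^{n-1}\mathrm{dist}(f^j(x),K)=0\}$. A statistical attractor (or Ilyashenko attractor) is a nonempty compact set $K\subset M$, invariant under $f$ in the sense $f^{-1}(K)=K$, with $m(A_K)>0$. It is $1$-observable if $m(A_K)=1$, and $1$-observable minimal if moreover it contains no proper nonempty compact subset that is a $1$-observable Ilyashenko attractor. A $1$-observable minimal Ilyashenko attractor exists and is unique. Let $\mathcal M$ be the space of Borel probability measures on $M$ with the weak$^*$ topology, and fix a metric $\mathrm{dist}^*$ on $\mathcal M$ inducing this topology. For $x\in M$, let $\sigma_{n,x}:=\frac1n\sum_{j=0}^{n-1}\delta_{f^j(x)}$ and let $p\omega(x)\subset\mathcal M$ be the set of limits of all convergent subsequences of $\{\sigma_{n,x}\}_{n\ge1}$. A measure $\mu\in\mathcal M$ is SRB-like (pseudo-physical) if for every $\epsilon>0$ the set $A_\epsilon(\mu):=\{x\in M:\ \mathrm{dist}^*(p\omega(x),\mu)<\epsilon\}$ has positive Lebesgue measure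 (here $\mathrm{dist}^*(p\omega(x),\mu)$ is the distance from the point $\mu$ to the compact set $p\omega(x)$). The set $\mathcal O_f$ of SRB-like measures is nonempty. The compact support of a nonempty set $\mathcal K$ of probability measures is the smallest compact set $K\subset M$ such that $\mu(K)=1$ for all $\mu\in\mathcal K$.
   Formalization: Invariance of an attractor is taken as f(K)=K instead of f^{-1}(K)=K (the same for bijective f), because with f^{-1}(K)=K the claim fails for constant maps; the manifold has dimension at least 1. *)

theory Defs
  imports "HOL-Probability.Probability"
begin

section \<open>Smooth Riemannian manifolds in coordinates\<close>

text \<open>
  Differentiability of order \<open>k\<close> on an open set \<open>S\<close>, through directional derivatives.
\<close>

primrec Ck_on :: "nat \<Rightarrow> ('a::real_normed_vector \<Rightarrow> 'b::real_normed_vector) \<Rightarrow> 'a set \<Rightarrow> bool" where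
  "Ck_on 0 f S \<longleftrightarrow> continuous_on S f"
| "Ck_on (Suc k) f S \<longleftrightarrow>
     (\<exists>f'. (\<forall>x\<in>S. (f has_derivative f' x) (at x)) \<and> (\<forall>v. Ck_on k (\<lambda>x. f' x v) S))"

definition smooth_on :: "('a::real_normed_vector \<Rightarrow> 'b::real_normed_vector) \<Rightarrow> 'a set \<Rightarrow> bool" where
  "smooth_on f S \<longleftrightarrow> (\<forall>k. Ck_on k f S)"

text \<open>
  A chart is a pair \<open>(U, \<phi>)\<close>; only the values of \<open>\<phi>\<close> on \<open>U\<close> matter.  The manifold is the
  whole type \<open>'m\<close>, of dimension \<open>CARD('n)\<close>.
\<close>

type_synonym ('m, 'n) chart = "'m set \<times> ('m \<Rightarrow> real ^ 'n)"

definition is_chart :: "('m::topological_space, 'n::finite) chart \<Rightarrow> bool" where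
  "is_chart c \<longleftrightarrow> open (fst c) \<and> open (snd c ` fst c) \<and>
     (\<exists>\<psi>. homeomorphism (fst c) (snd c ` fst c) (snd c) \<psi>)"

definition transition :: "('m, 'n::finite) chart \<Rightarrow> ('m, 'n) chart \<Rightarrow> real ^ 'n \<Rightarrow> real ^ 'n" where
  "transition c d = snd d \<circ> inv_into (fst c) (snd c)"

definition smooth_atlas :: "('m::topological_space, 'n::finite) chart set \<Rightarrow> bool" where
  "smooth_atlas A \<longleftrightarrow>
     (\<forall>c\<in>A. is_chart c) \<and> (\<Union>c\<in>A. fst c) = UNIV \<and>
     (\<forall>c\<in>A. \<forall>d\<in>A. smooth_on (transition c d) (snd c ` (fst c \<inter> fst d)))"

text \<open>
  \<open>g c y v w\<close> is the metric tensor in the chart \<open>c\<close>, at the point with coordinates \<open>y\<close>.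
\<close>

type_synonym ('m, 'n) metric_tensor =
  "('m, 'n) chart \<Rightarrow> real ^ 'n \<Rightarrow> real ^ 'n \<Rightarrow> real ^ 'n \<Rightarrow> real"

definition riemannian_metric ::
    "('m::topological_space, 'n::finite) chart set \<Rightarrow> ('m, 'n) metric_tensor \<Rightarrow> bool" where
  "riemannian_metric A g \<longleftrightarrow>
     (\<forall>c\<in>A. \<forall>y \<in> snd c ` fst c.
        bilinear (g c y) \<and> (\<forall>v w. g c y v w = g c y w v) \<and> (\<forall>v. v \<noteq> 0 \<longrightarrow> g c y v v > 0)) \<and>
     (\<forall>c\<in>A. \<forall>v w. smooth_on (\<lambda>y. g c y v w) (snd c ` fst c)) \<and>
     (\<forall>c\<in>A. \<forall>d\<in>A. \<forall>p \<in> fst c \<inter> fst d. \<forall>v w.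
        (let D = frechet_derivative (transition c d) (at (snd c p))
         in g c (snd c p) v w = g d (snd d p) (D v) (D w)))"

definition piecewise_C1_curve ::
    "('m::topological_space, 'n::finite) chart set \<Rightarrow> (real \<Rightarrow> 'm) \<Rightarrow> bool" where
  "piecewise_C1_curve A \<gamma> \<longleftrightarrow> continuous_on {0..1} \<gamma> \<and>
     (\<exists>S. finite S \<and> (\<forall>t \<in> {0<..<1} - S. \<exists>c\<in>A. \<exists>T. open T \<and> t \<in> T \<and> \<gamma> ` T \<subseteq> fst c \<and>
        (snd c \<circ> \<gamma>) C1_differentiable_on T))"

text \<open>
  By compatibility of the metric tensor with coordinate changes, the choice of the chart is
  immaterial.
\<close>

definition speed ::
    "('m, 'n::finite) chart set \<Rightarrow> ('m, 'n) metric_tensor \<Rightarrow> (real \<Rightarrow> 'm) \<Rightarrow> real \<Rightarrow> real" where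
  "speed A g \<gamma> t =
     (let c = (SOME c. c \<in> A \<and> \<gamma> t \<in> fst c); v = vector_derivative (snd c \<circ> \<gamma>) (at t)
      in sqrt (g c (snd c (\<gamma> t)) v v))"

definition curve_length ::
    "('m, 'n::finite) chart set \<Rightarrow> ('m, 'n) metric_tensor \<Rightarrow> (real \<Rightarrow> 'm) \<Rightarrow> ennreal" where
  "curve_length A g \<gamma> = (\<integral>\<^sup>+ t \<in> {0..1}. ennreal (speed A g \<gamma> t) \<partial>lborel)"

definition riemannian_distance ::
    "('m::topological_space, 'n::finite) chart set \<Rightarrow> ('m, 'n) metric_tensor \<Rightarrow> 'm \<Rightarrow> 'm \<Rightarrow> ennreal" where
  "riemannian_distance A g x y =
     (INF \<gamma> \<in> {\<gamma>. piecewise_C1_curve A \<gamma> \<and> \<gamma> 0 = x \<and> \<gamma> 1 = y}. curve_length A g \<gamma>)"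

text \<open>
  The distance of the type \<open>'m\<close> induces the manifold topology (charts are homeomorphisms) and
  agrees with the Riemannian distance wherever the latter is finite, i.e. on each connected
  component.  The manifold is not required to be connected.
\<close>

definition riemannian_manifold ::
    "('m::metric_space, 'n::finite) chart set \<Rightarrow> ('m, 'n) metric_tensor \<Rightarrow> bool" where
  "riemannian_manifold A g \<longleftrightarrow> smooth_atlas A \<and> riemannian_metric A g \<and>
     (\<forall>x y. connected_component UNIV x y \<longrightarrow> ennreal (dist x y) = riemannian_distance A g x y)"

definition volume_density ::
    "('m, 'n::finite) metric_tensor \<Rightarrow> ('m, 'n) chart \<Rightarrow> real ^ 'n \<Rightarrow> real" where
  "volume_density g c y = sqrt (det (\<chi> i j. g c y (axis i 1) (axis j 1)))"

definition riemannian_volume ::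
    "('m::metric_space, 'n::finite) chart set \<Rightarrow> ('m, 'n) metric_tensor \<Rightarrow> 'm measure \<Rightarrow> bool" where
  "riemannian_volume A g \<nu> \<longleftrightarrow> sets \<nu> = sets borel \<and>
     (\<forall>c\<in>A. \<forall>B \<in> sets borel. B \<subseteq> fst c \<longrightarrow>
        emeasure \<nu> B = (\<integral>\<^sup>+ y \<in> snd c ` B. ennreal (volume_density g c y) \<partial>lborel))"

definition normalized_volume ::
    "('m::metric_space, 'n::finite) chart set \<Rightarrow> ('m, 'n) metric_tensor \<Rightarrow> 'm measure \<Rightarrow> bool" where
  "normalized_volume A g m \<longleftrightarrow>
     (\<exists>\<nu> a. riemannian_volume A g \<nu> \<and> m = scale_measure a \<nu>) \<and> emeasure m UNIV = 1"


section \<open>Statistical attractors\<close>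

definition statistical_basin :: "('m::metric_space \<Rightarrow> 'm) \<Rightarrow> 'm set \<Rightarrow> 'm set" where
  "statistical_basin f K =
     {x. (\<lambda>n. (1 / real n) * (\<Sum>j<n. infdist ((f ^^ j) x) K)) \<longlonglongrightarrow> 0}"

text \<open>
  The paper writes invariance as \<open>f -` K = K\<close>.  For bijective \<open>f\<close> this is the same as
  \<open>f ` K = K\<close>.  For a non-injective continuous \<open>f\<close> the theorem fails if \<open>f -` K = K\<close> is
  taken literally: for a constant map with value \<open>p\<close> the only nonempty set with
  \<open>f -` K = K\<close> is the whole manifold, which is then the minimal attractor, whereas the only
  SRB-like measure is the Dirac measure at \<open>p\<close>, with support \<open>{p}\<close>.  Hence \<open>f ` K = K\<close>.
\<close>

definition invariant_set :: "('m \<Rightarrow> 'm) \<Rightarrow> 'm set \<Rightarrow> bool" where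
  "invariant_set f K \<longleftrightarrow> f ` K = K"

lemma invariant_set_bij: "bij f \<Longrightarrow> invariant_set f K \<longleftrightarrow> f -` K = K"
  unfolding invariant_set_def
  by (metis bij_is_inj bij_is_surj inj_vimage_image_eq surj_image_vimage_eq)

lemma vimage_invariant_const:
  assumes "K \<noteq> {}" and "(\<lambda>_. p) -` K = K"
  shows "K = UNIV"
  using assms by (auto split: if_splits)

definition statistical_attractor ::
    "'m measure \<Rightarrow> ('m::metric_space \<Rightarrow> 'm) \<Rightarrow> 'm set \<Rightarrow> bool" where
  "statistical_attractor m f K \<longleftrightarrow>
     K \<noteq> {} \<and> compact K \<and> invariant_set f K \<and> emeasure m (statistical_basin f K) > 0"

definition one_observable ::
    "'m measure \<Rightarrow> ('m::metric_space \<Rightarrow> 'm) \<Rightarrow> 'm set \<Rightarrow> bool" where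
  "one_observable m f K \<longleftrightarrow>
     statistical_attractor m f K \<and> emeasure m (statistical_basin f K) = 1"

definition one_observable_minimal ::
    "'m measure \<Rightarrow> ('m::metric_space \<Rightarrow> 'm) \<Rightarrow> 'm set \<Rightarrow> bool" where
  "one_observable_minimal m f K \<longleftrightarrow> one_observable m f K \<and>
     \<not> (\<exists>K'. K' \<subset> K \<and> K' \<noteq> {} \<and> compact K' \<and> one_observable m f K')"


section \<open>SRB-like measures\<close>

definition prob_measures :: "'m::topological_space measure set" where
  "prob_measures = {\<mu>. sets \<mu> = sets borel \<and> prob_space \<mu>}"

definition weak_star_topology :: "'m::topological_space measure topology" where
  "weak_star_topology = topology_generated_by
     {{\<mu> \<in> prob_measures. (\<integral>x. \<phi> x \<partial>\<mu>) \<in> U} | (\<phi> :: 'm \<Rightarrow> real) U.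
        continuous_on UNIV \<phi> \<and> open U}"

definition metrizes_weak_star ::
    "('m::topological_space measure \<Rightarrow> 'm measure \<Rightarrow> real) \<Rightarrow> bool" where
  "metrizes_weak_star d \<longleftrightarrow>
     Metric_space prob_measures d \<and> Metric_space.mtopology prob_measures d = weak_star_topology"

definition empirical_measure ::
    "('m::topological_space \<Rightarrow> 'm) \<Rightarrow> nat \<Rightarrow> 'm \<Rightarrow> 'm measure" where
  "empirical_measure f n x = measure_of UNIV (sets borel)
     (\<lambda>B. (\<Sum>j<n. emeasure (return borel ((f ^^ j) x)) B) / of_nat n)"

definition p_omega :: "('m::topological_space \<Rightarrow> 'm) \<Rightarrow> 'm \<Rightarrow> 'm measure set" where
  "p_omega f x = {\<mu>. \<exists>r. strict_mono r \<and> (\<forall>k. r k \<ge> 1) \<and>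
     limitin weak_star_topology (\<lambda>k. empirical_measure f (r k) x) \<mu> sequentially}"

definition SRB_like ::
    "'m measure \<Rightarrow> ('m measure \<Rightarrow> 'm measure \<Rightarrow> real) \<Rightarrow> ('m::topological_space \<Rightarrow> 'm) \<Rightarrow> 'm measure set" where
  "SRB_like m d f = {\<mu> \<in> prob_measures.
     \<forall>\<epsilon>>0. emeasure m {x. (INF \<nu> \<in> p_omega f x. d \<nu> \<mu>) < \<epsilon>} > 0}"

definition is_compact_support :: "'m::topological_space measure set \<Rightarrow> 'm set \<Rightarrow> bool" where
  "is_compact_support \<K> K \<longleftrightarrow>
     compact K \<and> (\<forall>\<mu>\<in>\<K>. emeasure \<mu> K = 1) \<and>
     (\<forall>K'. compact K' \<and> (\<forall>\<mu>\<in>\<K>. emeasure \<mu> K' = 1) \<longrightarrow> K \<subseteq> K')"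

end

(*
  Every limit of empirical measures gives full mass to K exactly when the time averages of
  dist(., K) tend to 0, so x lies in the basin of K iff all measures in p_omega(x) live on K.
  By weak* compactness, p_omega(x) consists of SRB-like measures for almost every x, and each
  SRB-like measure is approximated by such limits on a set of positive volume. Hence a compact K
  has a basin of full volume iff every SRB-like measure lives on K. SRB-like measures are
  f-invariant, so both the image and the preimage of their compact support K0 carry them;
  minimality then forces f(K0) = K0.
*)
theory Submission
  imports Defs
begin

section \<open>Compact metric spaces as continuous images of real sets\<close>

text \<open>Weak* compactness over a compact metric space is pulled back from the real line. Each
  point is coded by the real number that records which balls of a fixed sequence contain it. Such a
  coding is in general discontinuous, so limits of coded measures may charge reals that code no
  point; the construction is arranged so that decoding extends continuously to the closure of the
  codes, and the limit can be transported back. Afterwards, measures are tested with continuous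
  functions only. For a nonempty closed set the distance to it is such a function, and its integral
  vanishes exactly when the measure lives on the set. Two complementary facts then relate typical
  orbits to SRB-like measures: a weak* closed family without SRB-like measures is missed by
  \<open>p_omega f x\<close> for almost every \<open>x\<close>, while an open family containing one
  is not. Existence, invariance and the criterion for a basin of full volume all follow by choosing
  the family suitably.\<close>

definition ternary :: "(nat \<Rightarrow> bool) \<Rightarrow> real" where
  "ternary b = (\<Sum>k. of_bool (b k) * (1/3) ^ k)"

lemma summable_ternary: "summable (\<lambda>k. of_bool (b k) * (1/3) ^ k :: real)"
  by (rule summable_comparison_test'[where g = "\<lambda>k. (1/3) ^ k"]) auto

lemma ternary_nonneg: "0 \<le> ternary b"
  unfolding ternary_def by (intro suminf_nonneg summable_ternary) auto

lemma ternary_le: "ternary b \<le> 3/2"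
proof -
  have "ternary b \<le> (\<Sum>k. (1/3) ^ k)"
    unfolding ternary_def by (intro suminf_le summable_ternary) auto
  also have "\<dots> = 3/2" by (subst suminf_geometric) auto
  finally show ?thesis .
qed

text \<open>At the first index \<open>l\<close> where the sequences differ the terms differ by
  \<open>(1/3) ^ l\<close>, while all later terms together contribute at most half of that. Base 3
  with digits 0 and 1 leaves this gap; in base 2 different sequences could share a value.\<close>

lemma ternary_close_imp_eq:
  assumes close: "\<bar>ternary a - ternary b\<bar> < (1/3) ^ N / 2" and "k < N"
  shows "a k = b k"
proof (rule ccontr)
  assume "a k \<noteq> b k"
  define l where "l = (LEAST l. a l \<noteq> b l)"
  have l: "a l \<noteq> b l" "l \<le> k" "\<And>i. i < l \<Longrightarrow> a i = b i"
    unfolding l_def using LeastI[of "\<lambda>l. a l \<noteq> b l", OF \<open>a k \<noteq> b k\<close>]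
      Least_le[of "\<lambda>l. a l \<noteq> b l", OF \<open>a k \<noteq> b k\<close>] not_less_Least[of _ "\<lambda>l. a l \<noteq> b l"]
    by blast+
  define e :: "nat \<Rightarrow> real" where
    "e i = of_bool (a i) * (1/3) ^ i - of_bool (b i) * (1/3) ^ i" for i
  have e: "norm (e (i + Suc l)) \<le> (1/3) ^ Suc l * (1/3) ^ i" for i
    unfolding e_def by (cases "a (i + Suc l)"; cases "b (i + Suc l)") (auto simp: power_add)
  have "summable e"
    unfolding e_def by (intro summable_diff summable_ternary)
  have "ternary a - ternary b = (\<Sum>i. e i)"
    unfolding ternary_def e_def by (intro suminf_diff summable_ternary)
  also have "\<dots> = (\<Sum>i. e (i + Suc l)) + (\<Sum>i<Suc l. e i)"
    by (intro suminf_split_initial_segment \<open>summable e\<close>)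
  also have "(\<Sum>i<Suc l. e i) = e l"
    using l(3) by (simp add: e_def)
  finally have "\<bar>ternary a - ternary b\<bar> \<ge> \<bar>e l\<bar> - \<bar>\<Sum>i. e (i + Suc l)\<bar>"
    by linarith
  moreover have "\<bar>\<Sum>i. e (i + Suc l)\<bar> \<le> (1/3) ^ l / 2"
  proof -
    have "norm (\<Sum>i. e (i + Suc l)) \<le> (\<Sum>i. (1/3) ^ Suc l * (1/3) ^ i)"
      by (intro norm_suminf_le e summable_mult) auto
    also have "\<dots> = (1/3) ^ l / 2"
      by (subst suminf_mult) (auto simp: suminf_geometric)
    finally show ?thesis by simp
  qed
  moreover have "\<bar>e l\<bar> = (1/3) ^ l"
    using l(1) by (auto simp: e_def)
  moreover have "(1/3 :: real) ^ N \<le> (1/3) ^ l"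
    using \<open>l \<le> k\<close> \<open>k < N\<close> by (intro power_decreasing) auto
  ultimately show False
    using close by linarith
qed

text \<open>One sequence lists the balls of finite nets of every radius \<open>1 / Suc n\<close>.
  That \<open>N\<close> does not depend on \<open>x\<close> comes from the finiteness of a single
  net, and it later makes decoding uniformly continuous.\<close>

lemma compact_cover_sequence:
  assumes "compact (UNIV :: 'a::metric_space set)"
  obtains B :: "nat \<Rightarrow> 'a::metric_space set"
  where "\<And>k. open (B k)"
    and "\<And>\<epsilon>. \<epsilon> > 0 \<Longrightarrow> \<exists>N. \<forall>x. \<exists>k<N. x \<in> B k \<and> (\<forall>y\<in>B k. dist x y < \<epsilon>)"
proof -
  have "\<exists>F :: 'a set. finite F \<and> UNIV \<subseteq> (\<Union>p\<in>F. ball p (1 / Suc n))" for n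
  proof -
    have "0 < 1 / real (Suc n)" by simp
    then show ?thesis
      using seq_compact_imp_totally_bounded[OF compact_imp_seq_compact[OF assms]] by blast
  qed
  then obtain F :: "nat \<Rightarrow> 'a set"
    where F: "\<And>n. finite (F n)" "\<And>n. UNIV \<subseteq> (\<Union>p\<in>F n. ball p (1 / Suc n))"
    by metis
  define P where "P = (SIGMA n : UNIV. F n)"
  have "countable P"
    unfolding P_def using F(1) by (intro countable_SIGMA) (auto simp: countable_finite)
  have "P \<noteq> {}"
    using F(2)[of 0] by (auto simp: P_def)
  define B where "B k = (case from_nat_into P k of (n, p) \<Rightarrow> ball p (1 / Suc n))" for k
  show thesis
  proof
    show "open (B k)" for k
      by (auto simp: B_def split: prod.split)
    fix \<epsilon> :: real assume "\<epsilon> > 0"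
    then obtain n where n: "2 / Suc n < \<epsilon>"
      using nat_approx_posE[of "\<epsilon>/2"] by (auto simp: field_simps)
    \<comment> \<open>Just beyond the last position that a ball of the \<open>n\<close>-th net takes
      in the enumeration.\<close>
    define N where "N = Suc (Max ((\<lambda>p. to_nat_on P (n, p)) ` F n))"
    have "\<exists>k<N. x \<in> B k \<and> (\<forall>y\<in>B k. dist x y < \<epsilon>)" for x
    proof -
      obtain p where p: "p \<in> F n" "x \<in> ball p (1 / Suc n)"
        using F(2)[of n] by blast
      have "B (to_nat_on P (n, p)) = ball p (1 / Suc n)"
        using p \<open>countable P\<close> by (simp add: B_def P_def)
      moreover have "to_nat_on P (n, p) < N"
        unfolding N_def less_Suc_eq_le using p F(1) by (intro Max_ge) auto
      moreover have "dist x y < \<epsilon>" if "y \<in> ball p (1 / Suc n)" for y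
      proof -
        have "dist x y \<le> dist p x + dist p y"
          by (metis dist_commute dist_triangle)
        also have "\<dots> < 1 / Suc n + 1 / Suc n"
          using p(2) that by (intro add_strict_mono) auto
        finally show ?thesis using n by simp
      qed
      ultimately show ?thesis
        using p(2) by metis
    qed
    then show "\<exists>N. \<forall>x. \<exists>k<N. x \<in> B k \<and> (\<forall>y\<in>B k. dist x y < \<epsilon>)"
      by blast
  qed
qed

text \<open>The digits of \<open>c x\<close> tell which of the open balls contain \<open>x\<close>,
  whence \<open>c\<close> is Borel. Nearby codes share their first digits, hence a small ball, so
  the inverse of \<open>c\<close> is uniformly continuous; compactness of the space then lets it
  extend to limits of codes.\<close>

lemma compact_borel_coding:
  assumes compact: "compact (UNIV :: 'a::metric_space set)"
  obtains c :: "'a::metric_space \<Rightarrow> real" and h :: "real \<Rightarrow> 'a::metric_space"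
  where "c \<in> borel_measurable borel" "range c \<subseteq> {0..2}"
    "continuous_on (closure (range c)) h" "\<And>x. h (c x) = x"
proof -
  obtain B :: "nat \<Rightarrow> 'a set" where B: "\<And>k. open (B k)"
    and sep: "\<And>\<epsilon>. \<epsilon> > 0 \<Longrightarrow> \<exists>N. \<forall>x. \<exists>k<N. x \<in> B k \<and> (\<forall>y\<in>B k. dist x y < \<epsilon>)"
    using compact_cover_sequence[OF compact] by metis
  define c where "c x = ternary (\<lambda>k. x \<in> B k)" for x
  have [measurable]: "B k \<in> sets borel" for k
    using B by auto
  have c_measurable: "c \<in> borel_measurable borel"
    unfolding c_def ternary_def by measurable
  have c_range: "range c \<subseteq> {0..2}"
    unfolding c_def using ternary_nonneg ternary_le order_trans[OF ternary_le] by fastforce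
  have c_inv: "\<exists>\<delta>>0. \<forall>x y. \<bar>c x - c y\<bar> < \<delta> \<longrightarrow> dist x y < \<epsilon>" if "\<epsilon> > 0" for \<epsilon>
  proof -
    obtain N where N: "\<And>x. \<exists>k<N. x \<in> B k \<and> (\<forall>y\<in>B k. dist x y < \<epsilon>)"
      using sep[OF \<open>\<epsilon> > 0\<close>] by blast
    have "dist x y < \<epsilon>" if "\<bar>c x - c y\<bar> < (1/3) ^ N / 2" for x y
      using N[of x] ternary_close_imp_eq[OF that[unfolded c_def]] by auto
    then show ?thesis
      by (intro exI[of _ "(1/3) ^ N / 2"]) auto
  qed
  define D where "D = closure (range c)"
  \<comment> \<open>A limit \<open>t\<close> of codes is approached by codes of points; a convergent
    subsequence of these points supplies the candidate value at \<open>t\<close>.\<close>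
  have "\<exists>x s. s \<longlonglongrightarrow> x \<and> (\<lambda>n. c (s n)) \<longlonglongrightarrow> t" if "t \<in> D" for t
  proof -
    obtain u where u: "\<And>n. u n \<in> range c" "u \<longlonglongrightarrow> t"
      using \<open>t \<in> D\<close> unfolding D_def closure_sequential by blast
    then have "\<forall>n. \<exists>x. u n = c x" by blast
    then obtain s where s: "\<And>n. u n = c (s n)" by metis
    obtain x r where "strict_mono r" "(s \<circ> r) \<longlonglongrightarrow> x"
      using compact unfolding compact_eq_seq_compact_metric seq_compact_def by (metis UNIV_I)
    moreover have "(\<lambda>n. c ((s \<circ> r) n)) \<longlonglongrightarrow> t"
      using LIMSEQ_subseq_LIMSEQ[OF u(2) \<open>strict_mono r\<close>] by (simp add: s o_def)
    ultimately show ?thesis by blast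
  qed
  then obtain h s where h: "\<And>t. t \<in> D \<Longrightarrow> s t \<longlonglongrightarrow> h t" "\<And>t. t \<in> D \<Longrightarrow> (\<lambda>n. c (s t n)) \<longlonglongrightarrow> t"
    by metis
  have "h (c x) = x" for x
  proof -
    have "c x \<in> D" unfolding D_def by (simp add: closure_subset[THEN subsetD])
    \<comment> \<open>At an actual code the chosen sequence has no freedom: codes tending to
      \<open>c x\<close> force the points to tend to \<open>x\<close>, so \<open>h\<close> really
      extends the inverse.\<close>
    have "s (c x) \<longlonglongrightarrow> x"
    proof (rule tendstoI)
      fix \<epsilon> :: real assume "\<epsilon> > 0"
      then obtain \<delta> where \<delta>: "\<delta> > 0" "\<And>x y. \<bar>c x - c y\<bar> < \<delta> \<Longrightarrow> dist x y < \<epsilon>"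
        using c_inv by blast
      have "\<forall>\<^sub>F n in sequentially. dist (c (s (c x) n)) (c x) < \<delta>"
        using h(2)[OF \<open>c x \<in> D\<close>] \<delta>(1) by (rule tendstoD)
      then show "\<forall>\<^sub>F n in sequentially. dist (s (c x) n) x < \<epsilon>"
        by eventually_elim (auto simp: dist_real_def \<delta>(2))
    qed
    with h(1)[OF \<open>c x \<in> D\<close>] show ?thesis
      using LIMSEQ_unique by blast
  qed
  moreover have "continuous_on D h"
    unfolding continuous_on_iff
  proof safe
    fix t and \<epsilon> :: real assume "t \<in> D" "\<epsilon> > 0"
    then obtain \<delta> where \<delta>: "\<delta> > 0" "\<And>x y. \<bar>c x - c y\<bar> < \<delta> \<Longrightarrow> dist x y < \<epsilon> / 2"
      using c_inv[of "\<epsilon> / 2"] by auto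
    \<comment> \<open>Closeness of \<open>u\<close> and \<open>t\<close> passes to the codes
      approximating them, then to the coded points, and finally to their limits. The limit only
      preserves a weak inequality, hence \<open>\<epsilon> / 2\<close>.\<close>
    have "dist (h u) (h t) < \<epsilon>" if "u \<in> D" "dist u t < \<delta>" for u
    proof -
      have "(\<lambda>n. dist (c (s u n)) (c (s t n))) \<longlonglongrightarrow> dist u t"
        by (intro tendsto_dist h that \<open>t \<in> D\<close>)
      then have "\<forall>\<^sub>F n in sequentially. dist (c (s u n)) (c (s t n)) < \<delta>"
        using \<open>dist u t < \<delta>\<close> by (rule order_tendstoD)
      then have "\<forall>\<^sub>F n in sequentially. dist (s u n) (s t n) \<le> \<epsilon> / 2"
        by eventually_elim (rule less_imp_le, rule \<delta>(2), simp add: dist_real_def)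
      moreover have "(\<lambda>n. dist (s u n) (s t n)) \<longlonglongrightarrow> dist (h u) (h t)"
        by (intro tendsto_dist h that \<open>t \<in> D\<close>)
      ultimately have "dist (h u) (h t) \<le> \<epsilon> / 2"
        by (intro tendsto_upperbound[OF _ _ sequentially_bot])
      then show ?thesis using \<open>\<epsilon> > 0\<close> by simp
    qed
    then show "\<exists>\<delta>>0. \<forall>u\<in>D. dist u t < \<delta> \<longrightarrow> dist (h u) (h t) < \<epsilon>"
      using \<open>\<delta> > 0\<close> by blast
  qed
  ultimately show thesis
    using that c_measurable c_range unfolding D_def by blast
qed

section \<open>Weak* compactness\<close>

lemma prob_measures_D:
  assumes "\<mu> \<in> prob_measures"
  shows "sets \<mu> = sets borel" "space \<mu> = UNIV" "prob_space \<mu>"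
proof -
  show "sets \<mu> = sets borel" "prob_space \<mu>"
    using assms by (auto simp: prob_measures_def)
  then show "space \<mu> = UNIV"
    using sets_eq_imp_space_eq[of \<mu> borel] by simp
qed

lemma prob_space_distr_in_prob_measures:
  assumes "prob_space \<mu>" "g \<in> measurable \<mu> borel"
  shows "distr \<mu> borel g \<in> prob_measures"
  using assms by (simp add: prob_measures_def prob_space.prob_space_distr)

lemma continuous_on_compact_UNIV_bounded:
  fixes \<phi> :: "'a::topological_space \<Rightarrow> real"
  assumes "compact (UNIV :: 'a set)" "continuous_on UNIV \<phi>"
  obtains C where "0 \<le> C" "\<And>x. \<bar>\<phi> x\<bar> \<le> C"
proof -
  have "bounded (range \<phi>)"
    using assms by (intro compact_imp_bounded compact_continuous_image)
  then show thesis
    using that unfolding bounded_iff by (metis abs_ge_zero order_trans rangeI real_norm_def)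
qed

lemma prob_measures_integrable:
  fixes \<phi> :: "'a::topological_space \<Rightarrow> real"
  assumes "compact (UNIV :: 'a set)" "\<mu> \<in> prob_measures" "continuous_on UNIV \<phi>"
  shows "integrable \<mu> \<phi>"
proof -
  interpret prob_space \<mu> using assms prob_measures_D by blast
  obtain C where "\<And>x. \<bar>\<phi> x\<bar> \<le> C"
    using continuous_on_compact_UNIV_bounded assms by metis
  moreover have "\<phi> \<in> borel_measurable \<mu>"
    using assms prob_measures_D(1) by (metis borel_measurable_continuous_onI measurable_cong_sets)
  ultimately show ?thesis
    by (intro integrable_const_bound[where B = C]) auto
qed

lemma topspace_weak_star: "topspace weak_star_topology = (prob_measures :: 'a::topological_space measure set)"
proof -
  have "prob_measures \<subseteq> \<Union>{{\<mu> \<in> prob_measures. (\<integral>x. \<phi> x \<partial>\<mu>) \<in> U} | (\<phi> :: 'a \<Rightarrow> real) U.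
        continuous_on UNIV \<phi> \<and> open U}"
    by (rule Union_upper) (auto intro!: exI[of _ "\<lambda>_. 0"] exI[of _ UNIV])
  then show ?thesis
    unfolding weak_star_topology_def by auto
qed

lemma limitin_weak_star_in_prob_measures:
  "limitin weak_star_topology s \<mu> F \<Longrightarrow> \<mu> \<in> prob_measures"
  using limitin_topspace[of weak_star_topology] by (simp add: topspace_weak_star)

lemma openin_weak_star:
  fixes \<phi> :: "'a::topological_space \<Rightarrow> real"
  assumes "continuous_on UNIV \<phi>" "open U"
  shows "openin weak_star_topology {\<mu> \<in> prob_measures. (\<integral>x. \<phi> x \<partial>\<mu>) \<in> U}"
  unfolding weak_star_topology_def using assms by (intro topology_generated_by_Basis) auto

lemma limitin_topology_generated_by:
  assumes "l \<in> \<Union>S" "\<And>U. U \<in> S \<Longrightarrow> l \<in> U \<Longrightarrow> eventually (\<lambda>x. s x \<in> U) F"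
  shows "limitin (topology_generated_by S) s l F"
  unfolding limitin_def topology_generated_by_topspace openin_topology_generated_by_iff
proof safe
  show "l \<in> \<Union>S" by fact
  fix U assume "generate_topology_on S U" "l \<in> U"
  then show "eventually (\<lambda>x. s x \<in> U) F"
  proof induction
    case (UN K)
    then obtain k where "k \<in> K" "l \<in> k" by blast
    with UN have "eventually (\<lambda>x. s x \<in> k) F" by blast
    then show ?case by eventually_elim (use \<open>k \<in> K\<close> in blast)
  next
    case (Int U V)
    then have "eventually (\<lambda>x. s x \<in> U) F" "eventually (\<lambda>x. s x \<in> V) F" by simp_all
    then show ?case by eventually_elim simp
  next
    case (Basis U)
    then show ?case by (rule assms(2))
  qed simp
qed

lemma limitin_weak_star_iff:
  assumes s: "\<And>n. s n \<in> prob_measures"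
  shows "limitin weak_star_topology s \<mu> F \<longleftrightarrow> (\<mu> :: 'a::topological_space measure) \<in> prob_measures \<and>
    (\<forall>\<phi> :: 'a \<Rightarrow> real. continuous_on UNIV \<phi> \<longrightarrow> ((\<lambda>n. \<integral>x. \<phi> x \<partial>s n) \<longlongrightarrow> (\<integral>x. \<phi> x \<partial>\<mu>)) F)"
    (is "?L \<longleftrightarrow> ?R")
proof
  assume L: ?L
  then have \<mu>: "\<mu> \<in> prob_measures"
    using limitin_topspace[OF L] by (simp add: topspace_weak_star)
  have "((\<lambda>n. \<integral>x. \<phi> x \<partial>s n) \<longlongrightarrow> (\<integral>x. \<phi> x \<partial>\<mu>)) F" if "continuous_on UNIV \<phi>" for \<phi> :: "'a \<Rightarrow> real"
  proof (rule topological_tendstoI)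
    fix U :: "real set" assume "open U" "(\<integral>x. \<phi> x \<partial>\<mu>) \<in> U"
    then have "\<forall>\<^sub>F n in F. s n \<in> {\<mu> \<in> prob_measures. (\<integral>x. \<phi> x \<partial>\<mu>) \<in> U}"
      using L \<mu> openin_weak_star[OF that \<open>open U\<close>] unfolding limitin_def by blast
    then show "\<forall>\<^sub>F n in F. (\<integral>x. \<phi> x \<partial>s n) \<in> U"
      by eventually_elim auto
  qed
  with \<mu> show ?R by blast
next
  assume R: ?R
  show ?L
    unfolding weak_star_topology_def
  proof (rule limitin_topology_generated_by)
    show "\<mu> \<in> \<Union>{{\<mu> \<in> prob_measures. (\<integral>x. \<phi> x \<partial>\<mu>) \<in> U} | (\<phi> :: 'a \<Rightarrow> real) U.
        continuous_on UNIV \<phi> \<and> open U}"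
      using R topspace_weak_star unfolding weak_star_topology_def by auto
  next
    fix W assume "W \<in> {{\<mu> \<in> prob_measures. (\<integral>x. \<phi> x \<partial>\<mu>) \<in> U} | (\<phi> :: 'a \<Rightarrow> real) U.
        continuous_on UNIV \<phi> \<and> open U}" "\<mu> \<in> W"
    then obtain \<phi> :: "'a \<Rightarrow> real" and U where W: "W = {\<mu> \<in> prob_measures. (\<integral>x. \<phi> x \<partial>\<mu>) \<in> U}"
        "continuous_on UNIV \<phi>" "open U" "(\<integral>x. \<phi> x \<partial>\<mu>) \<in> U"
      by auto
    have "((\<lambda>n. \<integral>x. \<phi> x \<partial>s n) \<longlongrightarrow> (\<integral>x. \<phi> x \<partial>\<mu>)) F"
      using R W(2) by blast
    from topological_tendstoD[OF this W(3,4)]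
    have "\<forall>\<^sub>F n in F. (\<integral>x. \<phi> x \<partial>s n) \<in> U" .
    then show "\<forall>\<^sub>F n in F. s n \<in> W"
      by eventually_elim (use s W in auto)
  qed
qed

text \<open>
  Helly's selection theorem only covers measures on the line, so the measures are moved there
  by a Borel coding with a continuous inverse, which brings the limit back.
\<close>

lemma prob_measures_convergent_subsequence:
  assumes compact: "compact (UNIV :: 'a::metric_space set)"
    and s: "\<And>n. s n \<in> (prob_measures :: 'a measure set)"
  obtains r \<mu> where "strict_mono (r :: nat \<Rightarrow> nat)"
    "limitin weak_star_topology (\<lambda>n. s (r n)) \<mu> sequentially"
proof -
  obtain c :: "'a \<Rightarrow> real" and h :: "real \<Rightarrow> 'a"
    where c[measurable]: "c \<in> borel_measurable borel" and c_range: "range c \<subseteq> {0..2}"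
    and h: "continuous_on (closure (range c)) h" and hc: "\<And>x. h (c x) = x"
    using compact_borel_coding[OF compact] by metis
  define D where "D = closure (range c)"
  have cD: "c x \<in> D" for x
    unfolding D_def by (simp add: closure_subset[THEN subsetD])
  have D: "closed D" "D \<noteq> {}"
    using cD by (auto simp: D_def)
  have [measurable]: "D \<in> sets borel"
    using D(1) by (rule borel_closed)
  have cs[measurable]: "c \<in> borel_measurable (s n)" for n
    unfolding measurable_cong_sets[OF prob_measures_D(1)[OF s] refl] by (rule c)
  have prob: "prob_space (s n)" for n
    by (rule prob_measures_D(3)[OF s])
  define \<mu> where "\<mu> n = distr (s n) borel c" for n
  have \<mu>: "real_distribution (\<mu> n)" for n
    unfolding \<mu>_def by (intro prob_space.real_distribution_distr prob cs)
  have \<mu>_int: "(\<integral>t. \<psi> t \<partial>\<mu> n) = (\<integral>x. \<psi> (c x) \<partial>s n)" if "\<psi> \<in> borel_measurable borel"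
    for \<psi> :: "real \<Rightarrow> real" and n
    unfolding \<mu>_def by (intro integral_distr cs that)
  \<comment> \<open>All codes lie in \<open>{0..2}\<close>, so one half-open interval around it
    carries every coded measure.\<close>
  have "tight \<mu>"
    unfolding tight_def
  proof (intro conjI allI impI \<mu>)
    fix \<epsilon> :: real assume "\<epsilon> > 0"
    have "measure (\<mu> n) {-1<..2} = 1" for n
    proof -
      have "c -` {-1<..2} \<inter> space (s n) = space (s n)"
        using c_range by force
      then show ?thesis
        unfolding \<mu>_def by (simp add: measure_distr prob_space.prob_space[OF prob])
    qed
    then show "\<exists>a b. a < b \<and> (\<forall>n. 1 - \<epsilon> < measure (\<mu> n) {a<..b})"
      using \<open>\<epsilon> > 0\<close> by (intro exI[of _ "-1"] exI[of _ 2]) auto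
  qed
  then obtain r \<nu> where r: "strict_mono r" and \<nu>: "real_distribution \<nu>"
    and conv: "weak_conv_m (\<mu> \<circ> id \<circ> r) \<nu>"
    using tight_imp_convergent_subsubsequence[of \<mu> id] by (auto simp: strict_mono_id)
  interpret \<nu>: real_distribution \<nu> by fact
  have lim: "(\<lambda>n. \<integral>x. \<psi> (c x) \<partial>s (r n)) \<longlonglongrightarrow> (\<integral>t. \<psi> t \<partial>\<nu>)"
    if "continuous_on UNIV \<psi>" "\<And>t. \<bar>\<psi> t\<bar> \<le> C" for \<psi> :: "real \<Rightarrow> real" and C
  proof -
    have "(\<lambda>n. integral\<^sup>L ((\<mu> \<circ> id \<circ> r) n) \<psi>) \<longlonglongrightarrow> integral\<^sup>L \<nu> \<psi>"
      by (rule weak_conv_imp_integral_bdd_continuous_conv[OF _ \<nu> conv, where B = C])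
        (use that \<mu> in \<open>auto simp: continuous_on_eq_continuous_at\<close>)
    then show ?thesis
      using that by (simp add: \<mu>_int borel_measurable_continuous_onI)
  qed
  \<comment> \<open>A bounded continuous function vanishing exactly on \<open>D\<close>: it
    integrates to 0 against every coded measure, hence against the limit, which therefore lives on
    \<open>D\<close>.\<close>
  define \<psi> where "\<psi> t = min 1 (infdist t D)" for t
  have \<psi>: "continuous_on UNIV \<psi>" "\<And>t. \<bar>\<psi> t\<bar> \<le> 1"
    unfolding \<psi>_def by (auto intro!: continuous_intros simp: infdist_nonneg)
  have "(\<integral>t. \<psi> t \<partial>\<nu>) = 0"
  proof -
    have "(\<lambda>n. 0) \<longlonglongrightarrow> (\<integral>t. \<psi> t \<partial>\<nu>)"
      using lim[OF \<psi>] cD by (simp add: \<psi>_def)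
    then show ?thesis
      by (simp add: LIMSEQ_const_iff)
  qed
  moreover have "integrable \<nu> \<psi>"
    using \<psi> by (intro \<nu>.integrable_const_bound[where B = 1]) (simp_all add: borel_measurable_continuous_onI)
  moreover have "AE t in \<nu>. 0 \<le> \<psi> t"
    by (simp add: \<psi>_def infdist_nonneg)
  ultimately have "AE t in \<nu>. \<psi> t = 0"
    using integral_nonneg_eq_0_iff_AE[of \<nu> \<psi>] by simp
  then have AE_D: "AE t in \<nu>. t \<in> D"
    by eventually_elim (use D in \<open>auto simp: \<psi>_def in_closed_iff_infdist_zero min_def split: if_splits\<close>)
  \<comment> \<open>An arbitrary default value for decoding outside \<open>D\<close>, a null set for
    the limit.\<close>
  obtain p :: 'a where True by simp
  define h' where "h' t = (if t \<in> D then h t else p)" for t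
  have h'[measurable]: "h' \<in> borel_measurable borel"
    unfolding h'_def using h by (intro borel_measurable_continuous_on_if) (auto simp: D_def)
  then have h'_\<nu>: "h' \<in> measurable \<nu> borel"
    by simp
  have "limitin weak_star_topology (\<lambda>n. s (r n)) (distr \<nu> borel h') sequentially"
    unfolding limitin_weak_star_iff[OF s]
  proof (intro conjI allI impI)
    show "distr \<nu> borel h' \<in> prob_measures"
      by (intro prob_space_distr_in_prob_measures \<nu>.prob_space_axioms h'_\<nu>)
    fix \<phi> :: "'a \<Rightarrow> real" assume \<phi>: "continuous_on UNIV \<phi>"
    obtain C where C: "0 \<le> C" "\<And>x. \<bar>\<phi> x\<bar> \<le> C"
      using continuous_on_compact_UNIV_bounded[OF compact \<phi>] by metis
    \<comment> \<open>The decoded test function is continuous on \<open>D\<close> only; Tietze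
      extends it with the same bound to the whole line, where weak convergence applies.\<close>
    have "continuous_on D (\<lambda>t. \<phi> (h t))"
      using h \<phi> continuous_on_compose2 unfolding D_def by blast
    then obtain \<Phi> where \<Phi>: "continuous_on UNIV \<Phi>" "\<And>t. t \<in> D \<Longrightarrow> \<Phi> t = \<phi> (h t)" "\<And>t. \<bar>\<Phi> t\<bar> \<le> C"
      using Tietze[of D "\<lambda>t. \<phi> (h t)" UNIV C] C D by auto
    have "(\<lambda>n. \<integral>x. \<Phi> (c x) \<partial>s (r n)) \<longlonglongrightarrow> (\<integral>t. \<Phi> t \<partial>\<nu>)"
      by (rule lim[OF \<Phi>(1,3)])
    also have "(\<integral>t. \<Phi> t \<partial>\<nu>) = (\<integral>t. \<phi> (h' t) \<partial>\<nu>)"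
    proof (rule integral_cong_AE)
      show "\<Phi> \<in> borel_measurable \<nu>"
        using \<Phi>(1) by (simp add: borel_measurable_continuous_onI)
      show "(\<lambda>t. \<phi> (h' t)) \<in> borel_measurable \<nu>"
        using measurable_compose[OF h'_\<nu> borel_measurable_continuous_onI[OF \<phi>]] .
      show "AE t in \<nu>. \<Phi> t = \<phi> (h' t)"
        using AE_D by eventually_elim (simp add: h'_def \<Phi>(2))
    qed
    also have "\<dots> = (\<integral>x. \<phi> x \<partial>distr \<nu> borel h')"
      by (intro integral_distr[symmetric] h'_\<nu> borel_measurable_continuous_onI \<phi>)
    finally show "(\<lambda>n. \<integral>x. \<phi> x \<partial>s (r n)) \<longlonglongrightarrow> (\<integral>x. \<phi> x \<partial>distr \<nu> borel h')"
      by (simp add: \<Phi>(2) cD hc)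
  qed
  with r show thesis by (rule that)
qed

section \<open>Empirical measures\<close>

text \<open>The distance to a closed nonempty set is a nonnegative continuous function whose zeros
  are that set. Living on \<open>K\<close> thus becomes a condition on one integral, and such
  conditions survive weak* limits.\<close>

lemma integral_infdist_eq_0_iff:
  assumes "compact (UNIV :: 'a::metric_space set)" "\<mu> \<in> prob_measures" "closed K" "(K :: 'a set) \<noteq> {}"
  shows "(\<integral>x. infdist x K \<partial>\<mu>) = 0 \<longleftrightarrow> (AE x in \<mu>. x \<in> K)"
proof -
  have "integrable \<mu> (\<lambda>x. infdist x K)"
    by (intro prob_measures_integrable assms continuous_intros)
  then have "(\<integral>x. infdist x K \<partial>\<mu>) = 0 \<longleftrightarrow> (AE x in \<mu>. infdist x K = 0)"
    by (intro integral_nonneg_eq_0_iff_AE) (simp_all add: infdist_nonneg)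
  also have "\<dots> \<longleftrightarrow> (AE x in \<mu>. x \<in> K)"
    using assms by (simp add: in_closed_iff_infdist_zero)
  finally show ?thesis .
qed

lemma prob_measures_emeasure_eq_1_iff:
  assumes "\<mu> \<in> prob_measures" "closed K"
  shows "emeasure \<mu> K = 1 \<longleftrightarrow> (AE x in \<mu>. x \<in> K)"
proof -
  interpret prob_space \<mu> by (rule prob_measures_D(3)[OF assms(1)])
  have "K \<in> events"
    using borel_closed[OF assms(2)] prob_measures_D(1)[OF assms(1)] by simp
  then show ?thesis
    using prob_eq_1 by (auto simp: emeasure_eq_measure)
qed

text \<open>As the image of a uniform measure on \<open>n\<close> times, the empirical measure is
  visibly a probability measure and its integrals are finite averages. For \<open>n = 0\<close>
  there would be no time to average over.\<close>

lemma empirical_measure_eq_distr: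
  assumes "n \<ge> 1"
  shows "empirical_measure f n x =
    distr (uniform_count_measure {..<n}) borel (\<lambda>j. (f ^^ j) x)" (is "_ = ?N")
proof -
  have "(\<Sum>j<n. emeasure (return borel ((f ^^ j) x)) B) / of_nat n = emeasure ?N B"
    if "B \<in> sets borel" for B
  proof -
    have "(\<Sum>j<n. emeasure (return borel ((f ^^ j) x)) B) = (\<Sum>j<n. indicator B ((f ^^ j) x))"
      using that by (intro sum.cong) auto
    also have "\<dots> = of_nat (card ((\<lambda>j. (f ^^ j) x) -` B \<inter> {..<n}))"
      by (simp add: indicator_def sum_of_bool_eq Int_def vimage_def conj_commute)
    finally have "(\<Sum>j<n. emeasure (return borel ((f ^^ j) x)) B) / of_nat n =
        ennreal (card ((\<lambda>j. (f ^^ j) x) -` B \<inter> {..<n}) / n)"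
      using assms by (simp add: divide_ennreal ennreal_of_nat_eq_real_of_nat)
    then show ?thesis
      using that by (subst emeasure_distr) (auto simp: space_uniform_count_measure
          emeasure_uniform_count_measure sets_uniform_count_measure measurable_def)
  qed
  then have "empirical_measure f n x = measure_of UNIV (sets borel) (emeasure ?N)"
    unfolding empirical_measure_def
    by (intro measure_of_eq) (auto simp: sets.sigma_sets_eq[of borel, simplified])
  also have "\<dots> = ?N"
    using measure_of_of_measure[of ?N] by simp
  finally show ?thesis .
qed

lemma measurable_uniform_count_measure:
  "(g :: nat \<Rightarrow> 'a::topological_space) \<in> borel_measurable (uniform_count_measure A)"
  by (auto simp: measurable_def space_uniform_count_measure sets_uniform_count_measure)

lemma empirical_measure_in_prob_measures:
  assumes "n \<ge> 1"
  shows "empirical_measure f n x \<in> prob_measures"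
  unfolding empirical_measure_eq_distr[OF assms] using assms
  by (intro prob_space_distr_in_prob_measures prob_space_uniform_count_measure
      measurable_uniform_count_measure) (auto simp: lessThan_empty_iff)

lemma integral_empirical_measure:
  fixes \<phi> :: "'a::topological_space \<Rightarrow> real"
  assumes "n \<ge> 1" "continuous_on UNIV \<phi>"
  shows "(\<integral>y. \<phi> y \<partial>empirical_measure f n x) = (\<Sum>j<n. \<phi> ((f ^^ j) x)) / n"
  unfolding empirical_measure_eq_distr[OF assms(1)]
  by (subst integral_distr)
    (auto intro!: measurable_uniform_count_measure borel_measurable_continuous_onI assms(2)
      simp: integral_uniform_count_measure)

lemma continuous_on_funpow:
  assumes "continuous_on UNIV (f :: 'a::topological_space \<Rightarrow> 'a)"
  shows "continuous_on UNIV (f ^^ n)"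
proof (induction n)
  case (Suc n)
  then show ?case
    using assms continuous_on_compose[of UNIV "f ^^ n" f] continuous_on_subset by auto
qed (simp add: id_def)

text \<open>Needed for measurability: conditions on the \<open>d\<close>-distance of an empirical
  measure become open conditions on \<open>x\<close>. The preimage of a generating weak* open set
  only constrains a finite orbit average of a continuous function.\<close>

lemma continuous_map_empirical_measure:
  assumes "continuous_on UNIV (f :: 'a::topological_space \<Rightarrow> 'a)" "n \<ge> 1"
  shows "continuous_map euclidean weak_star_topology (empirical_measure f n)"
proof -
  have "open (empirical_measure f n -` {\<mu> \<in> prob_measures. (\<integral>x. \<phi> x \<partial>\<mu>) \<in> U})"
    if \<phi>: "continuous_on UNIV \<phi>" and U: "open U" for \<phi> :: "'a \<Rightarrow> real" and U
  proof -
    have "continuous_on UNIV (\<lambda>x. (\<Sum>j<n. \<phi> ((f ^^ j) x)) / n)"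
      using assms(2)
      by (intro continuous_intros continuous_on_compose2[OF \<phi> continuous_on_funpow[OF assms(1)]]) auto
    then have "open ((\<lambda>x. (\<Sum>j<n. \<phi> ((f ^^ j) x)) / n) -` U)"
      using U by (simp add: open_vimage)
    also have "(\<lambda>x. (\<Sum>j<n. \<phi> ((f ^^ j) x)) / n) -` U =
        empirical_measure f n -` {\<mu> \<in> prob_measures. (\<integral>x. \<phi> x \<partial>\<mu>) \<in> U}"
      using empirical_measure_in_prob_measures[OF assms(2)]
        integral_empirical_measure[OF assms(2) \<phi>] by (auto simp: vimage_def)
    finally show ?thesis .
  qed
  moreover have "range (empirical_measure f n) \<subseteq> topspace weak_star_topology"
    using empirical_measure_in_prob_measures[OF assms(2)] by (auto simp: topspace_weak_star)
  ultimately show ?thesis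
    unfolding weak_star_topology_def continuous_on_generated_topo_iff by auto
qed

section \<open>Limits of empirical measures\<close>

lemma p_omega_subset_prob_measures: "p_omega f x \<subseteq> prob_measures"
  by (auto simp: p_omega_def limitin_weak_star_in_prob_measures)

lemma p_omega_integral:
  assumes "\<nu> \<in> p_omega f x"
  obtains r where "strict_mono (r :: nat \<Rightarrow> nat)" "\<And>k. r k \<ge> 1"
    "\<And>\<phi> :: 'a::topological_space \<Rightarrow> real. continuous_on UNIV \<phi> \<Longrightarrow>
      (\<lambda>k. (\<Sum>j<r k. \<phi> ((f ^^ j) x)) / r k) \<longlonglongrightarrow> (\<integral>y. \<phi> y \<partial>\<nu>)"
proof -
  obtain r where r: "strict_mono r" "\<And>k. r k \<ge> 1"
    and lim: "limitin weak_star_topology (\<lambda>k. empirical_measure f (r k) x) \<nu> sequentially"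
    using assms unfolding p_omega_def by blast
  have "(\<lambda>k. (\<Sum>j<r k. \<phi> ((f ^^ j) x)) / r k) \<longlonglongrightarrow> (\<integral>y. \<phi> y \<partial>\<nu>)"
    if "continuous_on UNIV \<phi>" for \<phi> :: "'a \<Rightarrow> real"
    using lim[unfolded limitin_weak_star_iff[OF empirical_measure_in_prob_measures[OF r(2)]],
        THEN conjunct2, rule_format, OF that]
    by (simp add: integral_empirical_measure[OF r(2) that])
  with r show thesis by (rule that)
qed

text \<open>The Krylov-Bogolyubov argument: along an orbit the sum telescopes to two boundary terms,
  of total size at most \<open>2 * C\<close>, which vanish after division by the number of
  times.\<close>

lemma p_omega_invariant:
  fixes f :: "'a::metric_space \<Rightarrow> 'a"
  assumes "compact (UNIV :: 'a set)" "continuous_on UNIV f" "\<nu> \<in> p_omega f x"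
    and \<phi>: "continuous_on UNIV (\<phi> :: 'a \<Rightarrow> real)"
  shows "(\<integral>y. \<phi> (f y) - \<phi> y \<partial>\<nu>) = 0"
proof -
  obtain r where r: "strict_mono r" "\<And>k. r k \<ge> 1"
    and lim: "\<And>\<psi>. continuous_on UNIV \<psi> \<Longrightarrow>
      (\<lambda>k. (\<Sum>j<r k. \<psi> ((f ^^ j) x)) / r k) \<longlonglongrightarrow> (\<integral>y. \<psi> y \<partial>\<nu>)"
    using p_omega_integral[OF assms(3)] by metis
  obtain C where C: "\<And>x. \<bar>\<phi> x\<bar> \<le> C"
    using continuous_on_compact_UNIV_bounded[OF assms(1) \<phi>] by metis
  have "(\<Sum>j<n. \<phi> (f ((f ^^ j) x)) - \<phi> ((f ^^ j) x)) = \<phi> ((f ^^ n) x) - \<phi> x" for n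
    using sum_lessThan_telescope[of "\<lambda>j. \<phi> ((f ^^ j) x)" n] by simp
  moreover have "continuous_on UNIV (\<lambda>y. \<phi> (f y) - \<phi> y)"
    by (intro continuous_intros continuous_on_compose2[OF \<phi> assms(2)] \<phi>) auto
  ultimately have "(\<lambda>k. (\<phi> ((f ^^ r k) x) - \<phi> x) / r k) \<longlonglongrightarrow> (\<integral>y. \<phi> (f y) - \<phi> y \<partial>\<nu>)"
    using lim by fastforce
  moreover have "(\<lambda>k. (\<phi> ((f ^^ r k) x) - \<phi> x) / r k) \<longlonglongrightarrow> 0"
  proof (rule Lim_null_comparison)
    have "(\<lambda>n. 2 * C / real n) \<longlonglongrightarrow> 0"
      by (rule lim_const_over_n)
    then show "(\<lambda>k. 2 * C / r k) \<longlonglongrightarrow> 0"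
      using LIMSEQ_subseq_LIMSEQ[OF _ r(1)] by (fastforce simp: o_def)
    have "\<bar>\<phi> ((f ^^ r k) x) - \<phi> x\<bar> \<le> 2 * C" for k
      using C[of "(f ^^ r k) x"] C[of x] by linarith
    then show "\<forall>\<^sub>F k in sequentially. norm ((\<phi> ((f ^^ r k) x) - \<phi> x) / r k) \<le> 2 * C / r k"
      by (intro always_eventually) (simp add: divide_right_mono)
  qed
  ultimately show ?thesis
    using LIMSEQ_unique by blast
qed

section \<open>Statistical attractors and SRB-like measures\<close>

locale compact_dynamics =
  fixes m :: "'m::metric_space measure" and d :: "'m measure \<Rightarrow> 'm measure \<Rightarrow> real" and f :: "'m \<Rightarrow> 'm"
  assumes compact: "compact (UNIV :: 'm set)"
    and prob_m: "prob_space m"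
    and sets_m: "sets m = sets borel"
    and metrizes: "metrizes_weak_star d"
    and cont_f: "continuous_on UNIV f"
begin

sublocale weak: Metric_space prob_measures d
  using metrizes unfolding metrizes_weak_star_def by blast

lemma weak_topology: "weak.mtopology = weak_star_topology"
  using metrizes unfolding metrizes_weak_star_def by blast

lemma space_m: "space m = UNIV"
  using sets_eq_imp_space_eq[OF sets_m] by simp

text \<open>Metrizability by \<open>d\<close> turns the selection of convergent subsequences into
  compactness in terms of open covers, and closed subsets inherit it.\<close>

lemma compactin_weak_star:
  fixes F :: "'m measure set"
  assumes "closedin weak_star_topology F"
  shows "compactin weak_star_topology F"
proof -
  have "compactin weak.mtopology prob_measures"
    unfolding weak.compactin_sequentially
  proof (intro conjI allI impI subset_refl)
    fix \<sigma> :: "nat \<Rightarrow> 'm measure" assume "range \<sigma> \<subseteq> prob_measures"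
    then have "\<And>n. \<sigma> n \<in> prob_measures" by blast
    then obtain r \<mu> where "strict_mono r"
        "limitin weak_star_topology (\<lambda>n. \<sigma> (r n)) \<mu> sequentially"
      using prob_measures_convergent_subsequence[OF compact] by metis
    moreover from this(2) have "\<mu> \<in> prob_measures"
      by (rule limitin_weak_star_in_prob_measures)
    ultimately show "\<exists>l r. l \<in> prob_measures \<and> strict_mono r \<and> limitin weak.mtopology (\<sigma> \<circ> r) l sequentially"
      unfolding weak_topology o_def by (intro exI[of _ \<mu>] exI[of _ r]) simp
  qed
  then show ?thesis
    using assms closedin_subset[OF assms] unfolding weak_topology
    by (intro closed_compactin[of _ prob_measures F]) (simp_all add: topspace_weak_star)
qed

section \<open>Limit measures near a given measure, and measurability of that event\<close>

lemma p_omega_subsequence: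
  assumes s: "strict_mono (s :: nat \<Rightarrow> nat)" "\<And>k. s k \<ge> 1"
  obtains r \<nu> where "strict_mono r" "\<nu> \<in> p_omega f x"
    "limitin weak_star_topology (\<lambda>k. empirical_measure f (s (r k)) x) \<nu> sequentially"
proof -
  obtain r \<nu> where r: "strict_mono r"
      "limitin weak_star_topology (\<lambda>k. empirical_measure f (s (r k)) x) \<nu> sequentially"
    by (rule prob_measures_convergent_subsequence[OF compact, of "\<lambda>k. empirical_measure f (s k) x",
          OF empirical_measure_in_prob_measures[OF s(2)]])
      (rule that; assumption)
  then have "\<nu> \<in> p_omega f x"
    unfolding p_omega_def using s strict_mono_o[OF s(1) r(1)] by (auto intro!: exI[of _ "s \<circ> r"])
  with r show thesis using that by blast
qed

lemma p_omega_nonempty: "p_omega f x \<noteq> {}"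
  by (rule p_omega_subsequence[of Suc x]) (auto simp: strict_mono_def)

text \<open>The set written A_epsilon(mu) in the definition of SRB-like measures, with the distance
  to \<open>p_omega f x\<close> unfolded into a witness. The two agree because
  \<open>p_omega f x\<close> is nonempty and \<open>d\<close> is bounded below.\<close>

definition hits :: "'m measure \<Rightarrow> real \<Rightarrow> 'm set" where
  "hits \<mu> \<epsilon> = {x. \<exists>\<nu>\<in>p_omega f x. d \<nu> \<mu> < \<epsilon>}"

lemma INF_p_omega_less_eq_hits: "{x. (INF \<nu> \<in> p_omega f x. d \<nu> \<mu>) < \<epsilon>} = hits \<mu> \<epsilon>"
proof -
  have "bdd_below ((\<lambda>\<nu>. d \<nu> \<mu>) ` p_omega f x)" for x
    by (rule bdd_belowI[of _ 0]) auto
  then show ?thesis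
    unfolding hits_def using p_omega_nonempty by (simp add: cINF_less_iff)
qed

text \<open>Quantification over limit measures is replaced by countable quantification over times,
  which makes the set measurable. The slack \<open>1 / Suc i\<close> keeps the inequality strict in
  the limit; \<open>Suc n\<close> skips the empty average.\<close>

lemma hits_eq:
  assumes \<mu>: "\<mu> \<in> prob_measures"
  shows "hits \<mu> \<epsilon> =
    {x. \<exists>i. \<forall>N. \<exists>n\<ge>N. d (empirical_measure f (Suc n) x) \<mu> < \<epsilon> - 1 / Suc i}"
proof (intro set_eqI iffI)
  fix x assume "x \<in> hits \<mu> \<epsilon>"
  then obtain \<nu> r where \<nu>: "\<nu> \<in> prob_measures" "d \<nu> \<mu> < \<epsilon>" and r: "strict_mono r" "\<And>k. r k \<ge> 1"
    and lim: "limitin weak_star_topology (\<lambda>k. empirical_measure f (r k) x) \<nu> sequentially"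
    unfolding hits_def p_omega_def by (auto dest: limitin_weak_star_in_prob_measures)
  \<comment> \<open>Half of the gap between \<open>d \<nu> \<mu>\<close> and
    \<open>\<epsilon>\<close> becomes the slack; the other half absorbs the distance from the
    empirical measures to \<open>\<nu>\<close>.\<close>
  obtain i where "1 / Suc i < (\<epsilon> - d \<nu> \<mu>) / 2"
    using nat_approx_posE[of "(\<epsilon> - d \<nu> \<mu>) / 2"] \<nu> by auto
  have "\<exists>n\<ge>N. d (empirical_measure f (Suc n) x) \<mu> < \<epsilon> - 1 / Suc i" for N
  proof -
    have "0 < (\<epsilon> - d \<nu> \<mu>) / 2" using \<nu>(2) by simp
    then obtain k0 where k0: "\<And>k. k \<ge> k0 \<Longrightarrow> d (empirical_measure f (r k) x) \<nu> < (\<epsilon> - d \<nu> \<mu>) / 2"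
      using lim unfolding weak_topology[symmetric] weak.limit_metric_sequentially by meson
    \<comment> \<open>\<open>Suc N\<close> ensures \<open>r k \<ge> Suc N\<close>, so that
      \<open>r k\<close> is the successor of an index that is at least \<open>N\<close>.\<close>
    define k where "k = max k0 (Suc N)"
    have "d (empirical_measure f (r k) x) \<mu> \<le> d (empirical_measure f (r k) x) \<nu> + d \<nu> \<mu>"
      by (intro weak.triangle \<mu> \<nu> empirical_measure_in_prob_measures r)
    moreover have "d (empirical_measure f (r k) x) \<nu> < (\<epsilon> - d \<nu> \<mu>) / 2"
      by (rule k0) (simp add: k_def)
    ultimately have "d (empirical_measure f (r k) x) \<mu> < \<epsilon> - 1 / Suc i"
      using \<open>1 / Suc i < (\<epsilon> - d \<nu> \<mu>) / 2\<close> by argo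
    moreover have "r k \<ge> Suc N"
      using seq_suble[OF r(1), of k] by (simp add: k_def)
    then have "r k - 1 \<ge> N" "Suc (r k - 1) = r k"
      by auto
    ultimately show ?thesis by metis
  qed
  then show "x \<in> {x. \<exists>i. \<forall>N. \<exists>n\<ge>N. d (empirical_measure f (Suc n) x) \<mu> < \<epsilon> - 1 / Suc i}"
    by blast
next
  fix x assume "x \<in> {x. \<exists>i. \<forall>N. \<exists>n\<ge>N. d (empirical_measure f (Suc n) x) \<mu> < \<epsilon> - 1 / Suc i}"
  then obtain i where "\<forall>N. \<exists>n\<ge>N. d (empirical_measure f (Suc n) x) \<mu> < \<epsilon> - 1 / Suc i"
    by blast
  then have "infinite {n. d (empirical_measure f (Suc n) x) \<mu> < \<epsilon> - 1 / Suc i}"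
    unfolding infinite_nat_iff_unbounded_le by blast
  from infinite_enumerate[OF this] obtain s :: "nat \<Rightarrow> nat" where s: "strict_mono s"
      "\<And>k. d (empirical_measure f (Suc (s k)) x) \<mu> < \<epsilon> - 1 / Suc i"
    by auto
  have "strict_mono (\<lambda>k. Suc (s k))"
    using s(1) by (simp add: strict_mono_def)
  then obtain r \<nu> where r: "strict_mono r" and \<nu>: "\<nu> \<in> p_omega f x"
    and lim: "limitin weak_star_topology (\<lambda>k. empirical_measure f (Suc (s (r k))) x) \<nu> sequentially"
    by (rule p_omega_subsequence[where x = x]) (simp, (rule that; assumption))
  have "\<nu> \<in> prob_measures" using \<nu> p_omega_subset_prob_measures by blast
  have "0 < 1 / real (Suc i)" by simp
  then obtain k where k: "d (empirical_measure f (Suc (s (r k))) x) \<nu> < 1 / Suc i"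
    using lim unfolding weak_topology[symmetric] weak.limit_metric_sequentially by (meson order_refl)
  have "d \<nu> \<mu> \<le> d \<nu> (empirical_measure f (Suc (s (r k))) x) + d (empirical_measure f (Suc (s (r k))) x) \<mu>"
    by (intro weak.triangle \<mu> \<open>\<nu> \<in> prob_measures\<close> empirical_measure_in_prob_measures) simp
  also have "\<dots> < \<epsilon>"
    using k s(2)[of "r k"] weak.commute[of \<nu> "empirical_measure f (Suc (s (r k))) x"] by linarith
  finally show "x \<in> hits \<mu> \<epsilon>"
    using \<nu> unfolding hits_def by blast
qed

lemma hits_measurable:
  assumes \<mu>: "\<mu> \<in> prob_measures"
  shows "hits \<mu> \<epsilon> \<in> sets m"
proof -
  have [measurable]: "Measurable.pred borel (\<lambda>x. d (empirical_measure f (Suc n) x) \<mu> < c)" for n c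
  proof -
    have "openin euclidean {x \<in> topspace euclidean. empirical_measure f (Suc n) x \<in> weak.mball \<mu> c}"
      using continuous_map_empirical_measure[OF cont_f, of "Suc n"]
      by (intro openin_continuous_map_preimage[where Y = weak_star_topology])
        (auto simp: weak_topology[symmetric])
    also have "{x \<in> topspace euclidean. empirical_measure f (Suc n) x \<in> weak.mball \<mu> c} =
        {x. d (empirical_measure f (Suc n) x) \<mu> < c}"
      using \<mu> empirical_measure_in_prob_measures[of "Suc n" f] by (auto simp: weak.commute)
    finally show ?thesis
      by (simp add: pred_def borel_open)
  qed
  have "Measurable.pred borel
      (\<lambda>x. \<exists>i. \<forall>N. \<exists>n. n \<ge> N \<and> d (empirical_measure f (Suc n) x) \<mu> < \<epsilon> - 1 / Suc i)"
    by measurable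
  then show ?thesis
    unfolding hits_eq[OF \<mu>] sets_m by (simp add: pred_def)
qed

section \<open>SRB-like measures: approximation by typical limits, existence, invariance\<close>

lemma SRB_like_iff:
  "\<mu> \<in> SRB_like m d f \<longleftrightarrow> \<mu> \<in> prob_measures \<and> (\<forall>\<epsilon>>0. emeasure m (hits \<mu> \<epsilon>) > 0)"
  by (simp add: SRB_like_def INF_p_omega_less_eq_hits)

lemma SRB_like_prob_measures: "\<mu> \<in> SRB_like m d f \<Longrightarrow> \<mu> \<in> prob_measures"
  by (simp add: SRB_like_iff)

text \<open>Every member of \<open>F\<close> has a ball that the limit measures of almost every
  point avoid. By compactness finitely many of these balls cover \<open>F\<close>, so meeting
  \<open>F\<close> confines \<open>x\<close> to a finite union of null sets.\<close>

lemma AE_p_omega_disjoint: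
  assumes F: "closedin weak_star_topology F" and disj: "F \<inter> SRB_like m d f = {}"
  shows "AE x in m. p_omega f x \<inter> F = {}"
proof -
  have F_prob: "F \<subseteq> prob_measures"
    using closedin_subset[OF F] by (simp add: topspace_weak_star)
  then have "\<forall>\<mu>\<in>F. \<exists>\<epsilon>>0. emeasure m (hits \<mu> \<epsilon>) = 0"
    using disj SRB_like_iff by (metis disjoint_iff not_gr_zero subsetD)
  then obtain \<epsilon> where \<epsilon>: "\<And>\<mu>. \<mu> \<in> F \<Longrightarrow> \<epsilon> \<mu> > 0" "\<And>\<mu>. \<mu> \<in> F \<Longrightarrow> emeasure m (hits \<mu> (\<epsilon> \<mu>)) = 0"
    by metis
  have "F \<subseteq> \<Union>((\<lambda>\<mu>. weak.mball \<mu> (\<epsilon> \<mu>)) ` F)"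
    using \<epsilon>(1) F_prob weak.centre_in_mball_iff by blast
  moreover have "compactin weak.mtopology F"
    using compactin_weak_star[OF F] by (simp add: weak_topology)
  moreover have "openin weak.mtopology U" if "U \<in> (\<lambda>\<mu>. weak.mball \<mu> (\<epsilon> \<mu>)) ` F" for U
    using that by auto
  ultimately have "\<exists>\<B>. finite \<B> \<and> \<B> \<subseteq> (\<lambda>\<mu>. weak.mball \<mu> (\<epsilon> \<mu>)) ` F \<and> F \<subseteq> \<Union>\<B>"
    by (intro compactinD)
  then obtain \<B> where \<B>: "finite \<B>" "\<B> \<subseteq> (\<lambda>\<mu>. weak.mball \<mu> (\<epsilon> \<mu>)) ` F" "F \<subseteq> \<Union>\<B>"
    by (elim exE conjE)
  from finite_subset_image[OF \<B>(1,2)]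
  obtain G where G: "finite G" "G \<subseteq> F" "F \<subseteq> \<Union>((\<lambda>\<mu>. weak.mball \<mu> (\<epsilon> \<mu>)) ` G)"
    using \<B>(3) by auto
  have "AE x in m. x \<notin> hits \<mu> (\<epsilon> \<mu>)" if "\<mu> \<in> G" for \<mu>
    using hits_measurable \<epsilon>(2) G(2) F_prob that by (intro AE_not_in) (auto simp: null_sets_def)
  then have "AE x in m. \<forall>\<mu>\<in>G. x \<notin> hits \<mu> (\<epsilon> \<mu>)"
    using G(1) by (simp add: AE_finite_all)
  then show ?thesis
  proof eventually_elim
    case (elim x)
    show ?case
    proof (rule ccontr)
      assume "p_omega f x \<inter> F \<noteq> {}"
      then obtain \<nu> \<mu> where "\<nu> \<in> p_omega f x" "\<mu> \<in> G" "\<nu> \<in> weak.mball \<mu> (\<epsilon> \<mu>)"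
        using G(3) by blast
      then have "x \<in> hits \<mu> (\<epsilon> \<mu>)"
        unfolding hits_def by (auto simp: weak.commute)
      with elim \<open>\<mu> \<in> G\<close> show False by blast
    qed
  qed
qed

text \<open>The counterpart for open families: \<open>W\<close> contains a \<open>d\<close>-ball
  around \<open>\<mu>\<close>, and a set of positive measure has limit measures in that
  ball.\<close>

lemma SRB_like_not_AE_disjoint:
  assumes W: "openin weak_star_topology W" and \<mu>: "\<mu> \<in> SRB_like m d f" "\<mu> \<in> W"
  shows "\<not> (AE x in m. p_omega f x \<inter> W = {})"
proof
  assume AE: "AE x in m. p_omega f x \<inter> W = {}"
  obtain \<epsilon> where \<epsilon>: "\<epsilon> > 0" "weak.mball \<mu> \<epsilon> \<subseteq> W"
    using W \<mu>(2) unfolding weak_topology[symmetric] weak.openin_mtopology by blast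
  have \<mu>_prob: "\<mu> \<in> prob_measures" by (rule SRB_like_prob_measures[OF \<mu>(1)])
  from AE have "AE x in m. x \<notin> hits \<mu> \<epsilon>"
  proof eventually_elim
    case (elim x)
    then show ?case
      using \<epsilon>(2) \<mu>_prob p_omega_subset_prob_measures[of f x] unfolding hits_def
      by (auto simp: subset_iff weak.commute disjoint_iff)
  qed
  then have "emeasure m (hits \<mu> \<epsilon>) = 0"
    using hits_measurable[OF \<mu>_prob] by (subst (asm) AE_iff_measurable) (auto simp: space_m)
  then show False
    using \<mu>(1) \<epsilon>(1) SRB_like_iff by (metis less_irrefl)
qed

text \<open>Otherwise the closed family of all probability measures would be missed by almost every
  \<open>p_omega f x\<close>, although none of these is empty.\<close>

lemma SRB_like_nonempty: "SRB_like m d f \<noteq> {}"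
proof
  assume "SRB_like m d f = {}"
  then have "AE x in m. p_omega f x \<inter> prob_measures = {}"
    using closedin_topspace[of weak_star_topology]
    by (intro AE_p_omega_disjoint) (auto simp: topspace_weak_star)
  then have "AE x in m. False"
    by eventually_elim (use p_omega_nonempty p_omega_subset_prob_measures in blast)
  then show False
    using prob_space.AE_False[OF prob_m] by blast
qed

text \<open>Violating the identity for a fixed \<open>\<phi>\<close> is an open condition that no
  limit of empirical measures satisfies, so no SRB-like measure can satisfy it.\<close>

lemma SRB_like_invariant:
  assumes \<mu>: "\<mu> \<in> SRB_like m d f" and \<phi>: "continuous_on UNIV (\<phi> :: 'm \<Rightarrow> real)"
  shows "(\<integral>y. \<phi> (f y) \<partial>\<mu>) = (\<integral>y. \<phi> y \<partial>\<mu>)"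
proof -
  have \<phi>f: "continuous_on UNIV (\<lambda>y. \<phi> (f y))"
    by (rule continuous_on_compose2[OF \<phi> cont_f]) auto
  have \<mu>_prob: "\<mu> \<in> prob_measures" by (rule SRB_like_prob_measures[OF \<mu>])
  define W where "W = {\<nu> \<in> prob_measures. (\<integral>y. \<phi> (f y) - \<phi> y \<partial>\<nu>) \<in> - {0}}"
  have "openin weak_star_topology W"
    unfolding W_def by (intro openin_weak_star continuous_on_diff \<phi> \<phi>f) auto
  moreover have "AE x in m. p_omega f x \<inter> W = {}"
    using p_omega_invariant[OF compact cont_f _ \<phi>] by (auto simp: W_def)
  ultimately have "\<mu> \<notin> W"
    using SRB_like_not_AE_disjoint \<mu> by blast
  then have "(\<integral>y. \<phi> (f y) - \<phi> y \<partial>\<mu>) = 0"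
    using \<mu>_prob by (simp add: W_def)
  then show ?thesis
    using prob_measures_integrable[OF compact \<mu>_prob \<phi>] prob_measures_integrable[OF compact \<mu>_prob \<phi>f]
    by simp
qed

section \<open>Basins of attraction and their volume\<close>

lemma statistical_basin_measurable: "statistical_basin f K \<in> sets m"
proof -
  have [measurable]: "(\<lambda>x. (1 / real n) * (\<Sum>j<n. infdist ((f ^^ j) x) K)) \<in> borel_measurable borel" for n
    by (intro borel_measurable_continuous_onI continuous_intros continuous_on_funpow[OF cont_f])
  have "Measurable.pred borel (\<lambda>x. (\<lambda>n. (1 / real n) * (\<Sum>j<n. infdist ((f ^^ j) x) K)) \<longlonglongrightarrow> 0)"
    by measurable
  then show ?thesis
    unfolding statistical_basin_def sets_m by (simp add: pred_def)
qed

text \<open>Along the times defining \<open>\<nu>\<close> the averages of the distance tend to its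
  integral. Conversely, averages that stay above some \<open>\<epsilon>\<close> at infinitely many
  times yield, by compactness, a limit measure with integral at least
  \<open>\<epsilon>\<close>.\<close>

lemma statistical_basin_iff:
  "x \<in> statistical_basin f K \<longleftrightarrow> (\<forall>\<nu>\<in>p_omega f x. (\<integral>y. infdist y K \<partial>\<nu>) = 0)"
proof
  define u where "u n = (\<Sum>j<n. infdist ((f ^^ j) x) K) / n" for n
  have basin: "x \<in> statistical_basin f K \<longleftrightarrow> u \<longlonglongrightarrow> 0"
    unfolding statistical_basin_def u_def by simp
  have infdist: "continuous_on UNIV (\<lambda>y. infdist y K)"
    by (intro continuous_intros)
  show "\<forall>\<nu>\<in>p_omega f x. (\<integral>y. infdist y K \<partial>\<nu>) = 0" if "x \<in> statistical_basin f K"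
  proof
    fix \<nu> assume "\<nu> \<in> p_omega f x"
    then obtain r where "strict_mono r" and lim:
        "\<And>\<phi> :: 'm \<Rightarrow> real. continuous_on UNIV \<phi> \<Longrightarrow>
          (\<lambda>k. (\<Sum>j<r k. \<phi> ((f ^^ j) x)) / r k) \<longlonglongrightarrow> (\<integral>y. \<phi> y \<partial>\<nu>)"
      by (rule p_omega_integral) (rule that; assumption)
    moreover have "(\<lambda>k. u (r k)) \<longlonglongrightarrow> (\<integral>y. infdist y K \<partial>\<nu>)"
      unfolding u_def by (rule lim[OF infdist])
    moreover have "u \<longlonglongrightarrow> 0" using that basin by blast
    ultimately show "(\<integral>y. infdist y K \<partial>\<nu>) = 0"
      using LIMSEQ_unique LIMSEQ_subseq_LIMSEQ[of u 0 r] unfolding o_def by blast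
  qed
  show "x \<in> statistical_basin f K" if "\<forall>\<nu>\<in>p_omega f x. (\<integral>y. infdist y K \<partial>\<nu>) = 0"
  proof (rule ccontr)
    assume "x \<notin> statistical_basin f K"
    then obtain \<epsilon> where \<epsilon>: "\<epsilon> > 0" "\<forall>N. \<exists>n\<ge>N. \<not> norm (u n - 0) < \<epsilon>"
      unfolding basin LIMSEQ_iff by blast
    \<comment> \<open>Time 0 is excluded because only positive times have an empirical probability
      measure.\<close>
    have "\<exists>n\<ge>N. n \<in> {n. n \<ge> 1 \<and> \<epsilon> \<le> \<bar>u n\<bar>}" for N
    proof -
      obtain n where "n \<ge> max N 1" "\<not> norm (u n - 0) < \<epsilon>"
        using \<epsilon>(2) by blast
      then show ?thesis by (intro exI[of _ n]) auto
    qed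
    then have "infinite {n. n \<ge> 1 \<and> \<epsilon> \<le> \<bar>u n\<bar>}"
      unfolding infinite_nat_iff_unbounded_le by blast
    from infinite_enumerate[OF this]
    obtain s :: "nat \<Rightarrow> nat" where s: "strict_mono s" "\<forall>k. s k \<in> {n. n \<ge> 1 \<and> \<epsilon> \<le> \<bar>u n\<bar>}"
      by blast
    then have s_ge: "s k \<ge> 1" "\<epsilon> \<le> \<bar>u (s k)\<bar>" for k
      by blast+
    obtain r \<nu> where r: "strict_mono r" and \<nu>: "\<nu> \<in> p_omega f x"
      and lim: "limitin weak_star_topology (\<lambda>k. empirical_measure f (s (r k)) x) \<nu> sequentially"
      using p_omega_subsequence[OF s(1) s_ge(1)] by metis
    have "(\<lambda>k. u (s (r k))) \<longlonglongrightarrow> (\<integral>y. infdist y K \<partial>\<nu>)"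
      using lim[unfolded limitin_weak_star_iff[OF empirical_measure_in_prob_measures[OF s_ge(1)]],
          THEN conjunct2, rule_format, OF infdist]
      by (simp add: integral_empirical_measure[OF s_ge(1) infdist] u_def)
    then have "(\<lambda>k. \<bar>u (s (r k))\<bar>) \<longlonglongrightarrow> 0"
      using that \<nu> tendsto_rabs_zero by force
    then have "\<epsilon> \<le> 0"
      using s_ge(2) by (intro LIMSEQ_le_const) auto
    with \<epsilon>(1) show False by simp
  qed
qed

text \<open>A nonzero integral is an open condition, so one direction follows at once. For the
  other, being positive is not closed; it is split into the countably many closed conditions of
  being at least \<open>1 / Suc i\<close>, each avoided almost everywhere.\<close>

lemma statistical_basin_full_iff:
  assumes K: "compact K" "K \<noteq> {}"
  shows "emeasure m (statistical_basin f K) = 1 \<longleftrightarrow> (\<forall>\<mu>\<in>SRB_like m d f. emeasure \<mu> K = 1)"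
proof -
  interpret m: prob_space m by (rule prob_m)
  let ?I = "\<lambda>\<nu>. \<integral>y. infdist y K \<partial>\<nu>"
  have infdist: "continuous_on UNIV (\<lambda>y. infdist y K)"
    by (intro continuous_intros)
  have mass: "emeasure \<mu> K = 1 \<longleftrightarrow> ?I \<mu> = 0" if "\<mu> \<in> SRB_like m d f" for \<mu>
    using prob_measures_emeasure_eq_1_iff integral_infdist_eq_0_iff[OF compact]
      SRB_like_prob_measures[OF that] K compact_imp_closed by blast
  have "emeasure m (statistical_basin f K) = 1 \<longleftrightarrow> (AE x in m. x \<in> statistical_basin f K)"
    using m.prob_eq_1[OF statistical_basin_measurable] by (simp add: m.emeasure_eq_measure)
  also have "\<dots> \<longleftrightarrow> (AE x in m. \<forall>\<nu>\<in>p_omega f x. ?I \<nu> = 0)"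
    by (simp add: statistical_basin_iff)
  also have "\<dots> \<longleftrightarrow> (\<forall>\<mu>\<in>SRB_like m d f. ?I \<mu> = 0)"
  proof
    assume AE: "AE x in m. \<forall>\<nu>\<in>p_omega f x. ?I \<nu> = 0"
    define W where "W = {\<nu> \<in> prob_measures. ?I \<nu> \<in> - {0}}"
    have "openin weak_star_topology W"
      unfolding W_def by (intro openin_weak_star infdist) auto
    moreover have "AE x in m. p_omega f x \<inter> W = {}"
      using AE by eventually_elim (auto simp: W_def)
    ultimately have "\<mu> \<notin> W" if "\<mu> \<in> SRB_like m d f" for \<mu>
      using SRB_like_not_AE_disjoint that by blast
    then show "\<forall>\<mu>\<in>SRB_like m d f. ?I \<mu> = 0"
      using SRB_like_prob_measures by (auto simp: W_def)
  next
    assume I: "\<forall>\<mu>\<in>SRB_like m d f. ?I \<mu> = 0"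
    have "AE x in m. p_omega f x \<inter> {\<nu> \<in> prob_measures. ?I \<nu> \<in> {1 / Suc i..}} = {}" for i
    proof (rule AE_p_omega_disjoint)
      have eq: "{\<nu> \<in> prob_measures. ?I \<nu> \<in> {1 / Suc i..}} =
          topspace weak_star_topology - {\<nu> \<in> prob_measures. ?I \<nu> \<in> {..< 1 / Suc i}}"
        by (auto simp: topspace_weak_star)
      show "closedin weak_star_topology {\<nu> \<in> prob_measures. ?I \<nu> \<in> {1 / Suc i..}}"
        unfolding eq
        by (intro closedin_diff closedin_topspace openin_weak_star infdist open_lessThan)
      show "{\<nu> \<in> prob_measures. ?I \<nu> \<in> {1 / Suc i..}} \<inter> SRB_like m d f = {}"
        using I by (auto simp: field_simps)
    qed
    then have "AE x in m. \<forall>i. p_omega f x \<inter> {\<nu> \<in> prob_measures. ?I \<nu> \<in> {1 / Suc i..}} = {}"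
      by (simp add: AE_all_countable)
    then show "AE x in m. \<forall>\<nu>\<in>p_omega f x. ?I \<nu> = 0"
    proof eventually_elim
      case (elim x)
      show ?case
      proof
        fix \<nu> assume \<nu>: "\<nu> \<in> p_omega f x"
        then have "\<not> 1 / real (Suc i) \<le> ?I \<nu>" for i
          using elim p_omega_subset_prob_measures[of f x] by blast
        then have "\<not> 0 < ?I \<nu>"
          using nat_approx_posE by (metis less_imp_le)
        moreover have "0 \<le> ?I \<nu>"
          by (intro integral_nonneg_AE) (simp add: infdist_nonneg)
        ultimately show "?I \<nu> = 0" by simp
      qed
    qed
  qed
  finally show ?thesis
    using mass by blast
qed

lemma one_observable_iff:
  "one_observable m f K \<longleftrightarrow> compact K \<and> (\<forall>\<mu>\<in>SRB_like m d f. emeasure \<mu> K = 1) \<and> f ` K = K"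
proof (cases "K = {}")
  case True
  then show ?thesis
    \<comment> \<open>The right-hand side rules out the empty set since some SRB-like measure would
      have to give it mass 1.\<close>
    using SRB_like_nonempty by (auto simp: one_observable_def statistical_attractor_def)
next
  case False
  then show ?thesis
    using statistical_basin_full_iff[of K]
    by (auto simp: one_observable_def statistical_attractor_def invariant_set_def)
qed

section \<open>The compact support of the SRB-like measures\<close>

definition SRB_support :: "'m set" where
  "SRB_support = \<Inter>{K. compact K \<and> (\<forall>\<mu>\<in>SRB_like m d f. emeasure \<mu> K = 1)}"

lemma SRB_support_subset:
  "compact K \<Longrightarrow> (\<And>\<mu>. \<mu> \<in> SRB_like m d f \<Longrightarrow> emeasure \<mu> K = 1) \<Longrightarrow> SRB_support \<subseteq> K"
  unfolding SRB_support_def by blast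

lemma closed_SRB_support: "closed SRB_support"
  unfolding SRB_support_def by (intro closed_Inter) (auto intro: compact_imp_closed)

lemma compact_SRB_support: "compact SRB_support"
  using compact_Int_closed[OF compact closed_SRB_support] by simp

text \<open>An intersection of possibly uncountably many sets of full measure need not have full
  measure. A compact set outside it, however, is covered by finitely many complements of members,
  each of measure zero.\<close>

lemma AE_not_in_compact_disjoint_SRB_support:
  assumes C: "compact C" "C \<inter> SRB_support = {}" and \<mu>: "\<mu> \<in> SRB_like m d f"
  shows "AE x in \<mu>. x \<notin> C"
proof -
  let ?\<K> = "{K. compact K \<and> (\<forall>\<mu>\<in>SRB_like m d f. emeasure \<mu> K = 1)}"
  have cover: "C \<subseteq> (\<Union>K\<in>?\<K>. - K)"
    using C(2) unfolding SRB_support_def by blast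
  have "\<And>K. K \<in> ?\<K> \<Longrightarrow> open (- K)"
    using compact_imp_closed by blast
  from compactE_image[OF C(1) this cover]
  obtain G where G: "G \<subseteq> ?\<K>" "finite G" "C \<subseteq> (\<Union>K\<in>G. - K)"
    by blast
  have "AE x in \<mu>. x \<in> K" if "K \<in> G" for K
    using prob_measures_emeasure_eq_1_iff[OF SRB_like_prob_measures[OF \<mu>]] G(1) \<mu> that
      compact_imp_closed by blast
  then have "AE x in \<mu>. \<forall>K\<in>G. x \<in> K"
    using G(2) by (simp add: AE_finite_all)
  then show ?thesis
    by eventually_elim (use G(3) in blast)
qed

text \<open>If the support were empty, the whole compact space would be disjoint from it and hence
  null. This must precede the use of \<open>infdist\<close>, which is 0 for the empty set.\<close>

lemma SRB_support_nonempty: "SRB_support \<noteq> {}"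
proof
  assume "SRB_support = {}"
  obtain \<mu> where \<mu>: "\<mu> \<in> SRB_like m d f"
    using SRB_like_nonempty by blast
  have "AE x in \<mu>. False"
    using AE_not_in_compact_disjoint_SRB_support[OF compact _ \<mu>] \<open>SRB_support = {}\<close> by simp
  then show False
    using prob_space.AE_False[OF prob_measures_D(3)[OF SRB_like_prob_measures[OF \<mu>]]] by blast
qed

text \<open>The complement of the support is exhausted by countably many compact sets, those of the
  points at distance at least \<open>1 / Suc n\<close>.\<close>

lemma AE_in_SRB_support:
  assumes "\<mu> \<in> SRB_like m d f"
  shows "AE x in \<mu>. x \<in> SRB_support"
proof -
  have "AE x in \<mu>. x \<notin> {x. 1 / Suc n \<le> infdist x SRB_support}" for n
  proof (rule AE_not_in_compact_disjoint_SRB_support[OF _ _ assms])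
    have "closed {x. 1 / Suc n \<le> infdist x SRB_support}"
      by (intro closed_Collect_le continuous_intros)
    then show "compact {x. 1 / Suc n \<le> infdist x SRB_support}"
      using compact_Int_closed[OF compact] by simp
  qed auto
  then have "AE x in \<mu>. \<forall>n. x \<notin> {x. 1 / Suc n \<le> infdist x SRB_support}"
    by (simp add: AE_all_countable)
  then show ?thesis
  proof eventually_elim
    case (elim x)
    then have "\<not> 0 < infdist x SRB_support"
      using nat_approx_posE by (metis less_imp_le mem_Collect_eq)
    then have "infdist x SRB_support = 0"
      using infdist_nonneg[of x SRB_support] by simp
    then show ?case
      using closed_SRB_support SRB_support_nonempty by (simp add: in_closed_iff_infdist_zero)
  qed
qed

lemma emeasure_SRB_support: "\<mu> \<in> SRB_like m d f \<Longrightarrow> emeasure \<mu> SRB_support = 1"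
  using AE_in_SRB_support closed_SRB_support prob_measures_emeasure_eq_1_iff SRB_like_prob_measures
  by blast

text \<open>Invariance of the measures is available for continuous functions, not for indicators, so
  it is applied to the distance from the image and from the support itself; vanishing integrals are
  then read back as full measure.\<close>

lemma SRB_support_invariant: "f ` SRB_support = SRB_support"
proof
  have infdist: "continuous_on UNIV (\<lambda>y. infdist y K)" for K :: "'m set"
    by (intro continuous_intros)
  show "SRB_support \<subseteq> f ` SRB_support"
  proof (rule SRB_support_subset)
    show image: "compact (f ` SRB_support)"
      using compact_SRB_support cont_f continuous_on_subset by (intro compact_continuous_image) auto
    fix \<mu> assume \<mu>: "\<mu> \<in> SRB_like m d f"
    have "(\<integral>y. infdist y (f ` SRB_support) \<partial>\<mu>) = (\<integral>y. infdist (f y) (f ` SRB_support) \<partial>\<mu>)"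
      by (rule SRB_like_invariant[OF \<mu> infdist, symmetric])
    also have "\<dots> = 0"
      using AE_in_SRB_support[OF \<mu>] by (intro integral_eq_zero_AE) (auto elim!: eventually_mono)
    finally have "AE y in \<mu>. y \<in> f ` SRB_support"
      using integral_infdist_eq_0_iff[OF compact SRB_like_prob_measures[OF \<mu>]]
        SRB_support_nonempty compact_imp_closed[OF image] by simp
    then show "emeasure \<mu> (f ` SRB_support) = 1"
      using prob_measures_emeasure_eq_1_iff[OF SRB_like_prob_measures[OF \<mu>]]
        compact_imp_closed[OF image] by blast
  qed
  have "SRB_support \<subseteq> f -` SRB_support"
  proof (rule SRB_support_subset)
    have vimage: "closed (f -` SRB_support)"
      using closed_SRB_support cont_f by (simp add: closed_vimage)
    then show "compact (f -` SRB_support)"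
      using compact_Int_closed[OF compact] by simp
    fix \<mu> assume \<mu>: "\<mu> \<in> SRB_like m d f"
    note \<mu>_prob = SRB_like_prob_measures[OF \<mu>]
    have "(\<integral>y. infdist (f y) SRB_support \<partial>\<mu>) = (\<integral>y. infdist y SRB_support \<partial>\<mu>)"
      by (rule SRB_like_invariant[OF \<mu> infdist])
    also have "\<dots> = 0"
      using integral_infdist_eq_0_iff[OF compact \<mu>_prob closed_SRB_support SRB_support_nonempty]
        AE_in_SRB_support[OF \<mu>] by blast
    moreover have "integrable \<mu> (\<lambda>y. infdist (f y) SRB_support)"
      by (intro prob_measures_integrable[OF compact \<mu>_prob] continuous_on_compose2[OF infdist cont_f]) auto
    ultimately have "AE y in \<mu>. infdist (f y) SRB_support = 0"
      using integral_nonneg_eq_0_iff_AE[of \<mu> "\<lambda>y. infdist (f y) SRB_support"]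
      by (simp add: infdist_nonneg)
    then have "AE y in \<mu>. y \<in> f -` SRB_support"
      using closed_SRB_support SRB_support_nonempty by (simp add: in_closed_iff_infdist_zero)
    then show "emeasure \<mu> (f -` SRB_support) = 1"
      using prob_measures_emeasure_eq_1_iff[OF \<mu>_prob vimage] by blast
  qed
  then show "f ` SRB_support \<subseteq> SRB_support" by blast
qed

text \<open>The support is itself 1-observable and lies inside every 1-observable set. A least
  element is the only minimal one, which gives existence and uniqueness together.\<close>

lemma one_observable_minimal_iff: "one_observable_minimal m f K \<longleftrightarrow> K = SRB_support"
proof -
  have "one_observable m f SRB_support"
    using compact_SRB_support emeasure_SRB_support SRB_support_invariant by (simp add: one_observable_iff)
  moreover have "SRB_support \<subseteq> K" if "one_observable m f K" for K
    using that by (intro SRB_support_subset) (auto simp: one_observable_iff)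
  ultimately show ?thesis
    using SRB_support_nonempty compact_SRB_support unfolding one_observable_minimal_def by blast
qed

lemma is_compact_support_SRB_support: "is_compact_support (SRB_like m d f) SRB_support"
  unfolding is_compact_support_def
  using compact_SRB_support emeasure_SRB_support SRB_support_subset by blast

end

theorem mainTheorem11:
  fixes A :: "('m::metric_space, 'n::finite) chart set"
    and g :: "('m, 'n) metric_tensor"
    and m :: "'m measure"
    and d :: "'m measure \<Rightarrow> 'm measure \<Rightarrow> real"
    and f :: "'m \<Rightarrow> 'm"
  assumes "compact (UNIV :: 'm set)"
    and "riemannian_manifold A g"
    and "normalized_volume A g m"
    and "metrizes_weak_star d"
    and "continuous_on UNIV f"
  shows "(\<exists>!K. one_observable_minimal m f K) \<and>
    (\<forall>K. one_observable_minimal m f K \<longrightarrow> is_compact_support (SRB_like m d f) K)"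
proof -
  have sets_m: "sets m = sets borel" and mass: "emeasure m UNIV = 1"
    using assms(3) unfolding normalized_volume_def riemannian_volume_def by auto
  have "prob_space m"
    using mass sets_eq_imp_space_eq[OF sets_m] by (intro prob_spaceI) simp
  then interpret compact_dynamics m d f
    using assms sets_m by (intro compact_dynamics.intro)
  show ?thesis
    using one_observable_minimal_iff is_compact_support_SRB_support by simp
qed

end
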